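(* Suppose that each $U_i$ is concave and S.S.D. preserving, and that for every $i\in\mathcal N$ and every $Z\in\mathcal X$ the function $c\mapsto U_i(Z+c)$ on $\mathbb R$ is continuous, strictly increasing, and satisfies $\lim_{c\to\infty}U_i(Z+c)=\infty$. Then $\mathcal{PO}\neq\varnothing$ if and only if $\mathcal{CPO}\neq\varnothing$. Moreover, when Pareto optima and comonotone Pareto optima exist, for all $\lambda\in\Lambda$, $$\sup_{(Y_i)\in\mathcal{IR}}\sum_{i=1}^n\lambda_iU_i(Y_i)=\sup_{(Y_i)\in\mathcal{IR}\cap\mathcal A_C}\sum_{i=1}^n\lambda_iU_i(Y_i).$$
   Context: Let $(\Omega,\mathcal F,\mathbb P)$ be an atomless probability space and $\mathcal X:=L^\infty(\Omega,\mathcal F,\mathbb P)$. There are $n\in\mathbb N$ agents indexed by $\mathcal N=\{1,\dots,n\}$ (with $n\ge 2$), agent $i$ having initial endowment $X_i\in\mathcal X$; the aggregate endowment is $S:=\sum_{i=1}^n X_i$. The set of allocations is $\mathcal A:=\{(Y_1,\dots,Y_n)\in\mathcal X^n:\sum_{i=1}^nY_i=S\}$. Each agent $i$ has a utility functional $U_i:\mathcal X\to\mathbb R$. An allocation is individually rational (IR) if $U_i(Y_i)\ge U_i(X_i)$ for all $i$; $\mathcal{IR}$ is the set of IR allocations. An allocation $(Y_i^* )\in\mathcal A$ is Pareto optimal (PO) if it is IR and there is no other IR allocation $(Y_i)$ with $U_i(Y_i)\ge U_i(Y_i^* )$ for all $i$ and at least one strict inequality; $\mathcal{PO}$ is the set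 of PO allocations. A random vector $(Z_1,\dots,Z_n)$ is comonotone if $(Z_i(\omega_1)-Z_i(\omega_2))(Z_j(\omega_1)-Z_j(\omega_2))\ge0$ for all $\omega_1,\omega_2$, $i,j$. $\mathcal A_C$ is the set of comonotone allocations. An allocation $(Y_i^* )\in\mathcal A_C$ is comonotone Pareto optimal (CPO) if it is IR and there is no other IR allocation in $\mathcal A_C$ weakly improving all agents and strictly improving one; $\mathcal{CPO}$ is the set of CPO allocations. $\Lambda:=\mathbb R_+^n\setminus\{0\}$. For $Z_1,Z_2\in\mathcal X$, $Z_1\preccurlyeq_{ICV}Z_2$ (increasing concave order / second-order stochastic dominance) means $\mathbb E[\phi(Z_1)]\le\mathbb E[\phi(Z_2)]$ for every non-decreasing concave $\phi:\mathbb R\to\mathbb R$. A functional $U$ is S.S.D. preserving if $Z_1\preccurlyeq_{ICV}Z_2$ implies $U(Z_1)\le U(Z_2)$. *)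

theory Defs
  imports "HOL-Probability.Probability"
begin

definition atomless :: "'a measure \<Rightarrow> bool" where
  "atomless M \<longleftrightarrow> (\<forall>A\<in>sets M. measure M A > 0 \<longrightarrow>
      (\<exists>B\<in>sets M. B \<subseteq> A \<and> 0 < measure M B \<and> measure M B < measure M A))"

definition Linf :: "'a measure \<Rightarrow> ('a \<Rightarrow> real) set" where
  "Linf M = {Z. Z \<in> borel_measurable M \<and> (\<exists>C. \<forall>\<omega>\<in>space M. \<bar>Z \<omega>\<bar> \<le> C)}"

definition allocs :: "'a measure \<Rightarrow> nat \<Rightarrow> (nat \<Rightarrow> 'a \<Rightarrow> real) \<Rightarrow> (nat \<Rightarrow> 'a \<Rightarrow> real) set" where
  "allocs M n X = {Y. (\<forall>i\<in>{1..n}. Y i \<in> Linf M) \<and>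
      (\<forall>\<omega>\<in>space M. (\<Sum>i=1..n. Y i \<omega>) = (\<Sum>i=1..n. X i \<omega>))}"

definition comonotone :: "'a measure \<Rightarrow> nat \<Rightarrow> (nat \<Rightarrow> 'a \<Rightarrow> real) \<Rightarrow> bool" where
  "comonotone M n Y \<longleftrightarrow> (\<forall>i\<in>{1..n}. \<forall>j\<in>{1..n}. \<forall>\<omega>1\<in>space M. \<forall>\<omega>2\<in>space M.
      (Y i \<omega>1 - Y i \<omega>2) * (Y j \<omega>1 - Y j \<omega>2) \<ge> 0)"

definition allocsC :: "'a measure \<Rightarrow> nat \<Rightarrow> (nat \<Rightarrow> 'a \<Rightarrow> real) \<Rightarrow> (nat \<Rightarrow> 'a \<Rightarrow> real) set" where
  "allocsC M n X = {Y \<in> allocs M n X. comonotone M n Y}"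

definition IR :: "'a measure \<Rightarrow> nat \<Rightarrow> (nat \<Rightarrow> 'a \<Rightarrow> real) \<Rightarrow> (nat \<Rightarrow> ('a \<Rightarrow> real) \<Rightarrow> real)
    \<Rightarrow> (nat \<Rightarrow> 'a \<Rightarrow> real) set" where
  "IR M n X U = {Y \<in> allocs M n X. \<forall>i\<in>{1..n}. U i (Y i) \<ge> U i (X i)}"

definition PO :: "'a measure \<Rightarrow> nat \<Rightarrow> (nat \<Rightarrow> 'a \<Rightarrow> real) \<Rightarrow> (nat \<Rightarrow> ('a \<Rightarrow> real) \<Rightarrow> real)
    \<Rightarrow> (nat \<Rightarrow> 'a \<Rightarrow> real) set" where
  "PO M n X U = {Y \<in> IR M n X U. \<not> (\<exists>Y'\<in>IR M n X U.
      (\<forall>i\<in>{1..n}. U i (Y' i) \<ge> U i (Y i)) \<and> (\<exists>i\<in>{1..n}. U i (Y' i) > U i (Y i)))}"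

definition CPO :: "'a measure \<Rightarrow> nat \<Rightarrow> (nat \<Rightarrow> 'a \<Rightarrow> real) \<Rightarrow> (nat \<Rightarrow> ('a \<Rightarrow> real) \<Rightarrow> real)
    \<Rightarrow> (nat \<Rightarrow> 'a \<Rightarrow> real) set" where
  "CPO M n X U = {Y \<in> IR M n X U \<inter> allocsC M n X. \<not> (\<exists>Y'\<in>IR M n X U \<inter> allocsC M n X.
      (\<forall>i\<in>{1..n}. U i (Y' i) \<ge> U i (Y i)) \<and> (\<exists>i\<in>{1..n}. U i (Y' i) > U i (Y i)))}"

definition weights :: "nat \<Rightarrow> (nat \<Rightarrow> real) set" where
  "weights n = {w. (\<forall>i\<in>{1..n}. w i \<ge> 0) \<and> (\<exists>i\<in>{1..n}. w i \<noteq> 0)}"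

definition icv_le :: "'a measure \<Rightarrow> ('a \<Rightarrow> real) \<Rightarrow> ('a \<Rightarrow> real) \<Rightarrow> bool" where
  "icv_le M Z1 Z2 \<longleftrightarrow> (\<forall>\<phi> :: real \<Rightarrow> real. mono \<phi> \<and> concave_on UNIV \<phi> \<longrightarrow>
      integral\<^sup>L M (\<lambda>\<omega>. \<phi> (Z1 \<omega>)) \<le> integral\<^sup>L M (\<lambda>\<omega>. \<phi> (Z2 \<omega>)))"

definition ssd_preserving :: "'a measure \<Rightarrow> (('a \<Rightarrow> real) \<Rightarrow> real) \<Rightarrow> bool" where
  "ssd_preserving M V \<longleftrightarrow> (\<forall>Z1\<in>Linf M. \<forall>Z2\<in>Linf M. icv_le M Z1 Z2 \<longrightarrow> V Z1 \<le> V Z2)"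

definition concave_functional :: "'a measure \<Rightarrow> (('a \<Rightarrow> real) \<Rightarrow> real) \<Rightarrow> bool" where
  "concave_functional M V \<longleftrightarrow> (\<forall>Z1\<in>Linf M. \<forall>Z2\<in>Linf M. \<forall>t::real. 0 \<le> t \<and> t \<le> 1 \<longrightarrow>
      V (\<lambda>\<omega>. t * Z1 \<omega> + (1 - t) * Z2 \<omega>) \<ge> t * V Z1 + (1 - t) * V Z2)"

end

(* The theorem reduces to the comonotone improvement theorem: every bounded allocation Y of S
   is dominated, agent by agent in the increasing concave order, by a comonotone one. Among all
   allocations of S that dominate Y and stay in a fixed box, take one with the least
   sum of second moments; it exists by the projection argument of Hilbert spaces, since this set
   is convex and closed under almost sure limits. If agents i and j were not comonotone,
   a small mean-preserving transfer from i to j where i is high and j is low, and back where i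
   is low and j is high, would improve both of them and lower the second moments. So
   the minimizer is comonotone off a null set, where its components are non-decreasing
   functions of S. These extend to the real line with sum the identity, and
   this repairs the null set. *)

theory Submission
  imports Defs
begin

section \<open>Comonotone families as non-decreasing functions of their sum\<close>

text \<open>Were component \<open>i\<close> strictly larger at \<open>x\<close>, its products with
  the others would force every component to be at least as large there, and the sums would be
  strictly ordered the other way.\<close>

lemma comonotone_sum_le_imp_le:
  fixes Z :: "'i \<Rightarrow> 'b \<Rightarrow> real"
  assumes "finite I" "i \<in> I"
    and com: "\<And>i j. i \<in> I \<Longrightarrow> j \<in> I \<Longrightarrow> 0 \<le> (Z i x - Z i y) * (Z j x - Z j y)"
    and le: "(\<Sum>i\<in>I. Z i x) \<le> (\<Sum>i\<in>I. Z i y)"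
  shows "Z i x \<le> Z i y"
proof (rule ccontr)
  assume "\<not> ?thesis"
  then have gt: "Z i y < Z i x" by simp
  have "Z j y \<le> Z j x" if "j \<in> I" for j
    using com[OF assms(2) that] gt by (simp add: zero_le_mult_iff)
  then have "(\<Sum>i\<in>I. Z i y) < (\<Sum>i\<in>I. Z i x)"
    using assms(1,2) gt by (intro sum_strict_mono_ex1) auto
  with le show False by simp
qed

text \<open>One component at a time is split off as a function of the total sum, and the induction
  hypothesis treats the others as functions of what is left. The functions live on the whole line
  and sum to the identity everywhere, since they are later evaluated at sums that need not be
  attained on \<open>A\<close>.\<close>

lemma comonotone_imp_mono_of_sum:
  fixes Z :: "'i \<Rightarrow> 'b \<Rightarrow> real"
  assumes "finite I" "I \<noteq> {}"
    and "\<And>i j x y. \<lbrakk>i \<in> I; j \<in> I; x \<in> A; y \<in> A\<rbrakk> \<Longrightarrow> 0 \<le> (Z i x - Z i y) * (Z j x - Z j y)"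
  shows "\<exists>f. (\<forall>i\<in>I. mono (f i)) \<and> (\<forall>s. (\<Sum>i\<in>I. f i s) = s) \<and>
    (\<forall>i\<in>I. \<forall>x\<in>A. f i (\<Sum>i\<in>I. Z i x) = Z i x)"
proof (cases "A = {}")
  case True
  have c: "card I > 0" using assms by (simp add: card_gt_0_iff)
  \<comment> \<open>With \<open>A\<close> empty nothing has to be interpolated, and an equal split
    among the components does the rest.\<close>
  show ?thesis
    using True c by (intro exI[of _ "\<lambda>i s. s / real (card I)"]) (auto simp: mono_def divide_right_mono)
next
  case False
  then obtain x0 where x0: "x0 \<in> A" by blast
  show ?thesis using assms
  proof (induction I rule: finite_ne_induct)
    case (singleton k)
    show ?case by (intro exI[of _ "\<lambda>i s. s"]) (auto simp: mono_def)
  next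
    case (insert k F)
    define S where "S x = (\<Sum>i\<in>insert k F. Z i x)" for x
    define R where "R x = (\<Sum>i\<in>F. Z i x)" for x
    have SR: "S x = Z k x + R x" for x using insert.hyps by (simp add: S_def R_def)
    obtain g where g: "\<And>i. i \<in> F \<Longrightarrow> mono (g i)" "\<And>s. (\<Sum>i\<in>F. g i s) = s"
      "\<And>i x. i \<in> F \<Longrightarrow> x \<in> A \<Longrightarrow> g i (R x) = Z i x"
      using insert.IH insert.prems unfolding R_def by (metis insertCI)
    have le: "Z i x \<le> Z i y" if "S x \<le> S y" "x \<in> A" "y \<in> A" "i \<in> insert k F" for i x y
    proof (rule comonotone_sum_le_imp_le[of "insert k F" i Z x y])
      show "finite (insert k F)" using insert.hyps(1) by simp
      show "i \<in> insert k F" by fact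
      show "(\<Sum>i\<in>insert k F. Z i x) \<le> (\<Sum>i\<in>insert k F. Z i y)" using that(1) unfolding S_def .
    qed (rule insert.prems, assumption, assumption, rule that, rule that)
    have leR: "R x \<le> R y" if "S x \<le> S y" "x \<in> A" "y \<in> A" for x y
      unfolding R_def using le[OF that] by (intro sum_mono) auto
    \<comment> \<open>McShane-type extension of the k-th component as a function of the sum: non-decreasing and
      1-Lipschitz, so the remainder \<open>s - h s\<close> is non-decreasing and can be split by induction\<close>
    define H where "H s x = Z k x + max 0 (s - S x)" for s x
    define h where "h s = (INF x\<in>A. H s x)" for s
    \<comment> \<open>This makes \<open>h\<close> exact at attained sums. If \<open>S y\<close> is
      at most \<open>S x\<close>, monotonicity of component \<open>k\<close> suffices; otherwise
      \<open>H (S y) x\<close> exceeds \<open>Z k y\<close> by \<open>R y - R x\<close>, which is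
      non-negative.\<close>
    have low: "Z k y \<le> H (S y) x" if "x \<in> A" "y \<in> A" for x y
      using le[of y x k] leR[of x y] that unfolding H_def SR[of y] SR[of x]
      by (cases "S y \<le> S x") (auto simp: SR max_def)
    have lip: "H t x \<le> H s x + (t - s)" "H s x \<le> H t x" if "s \<le> t" for s t x
      using that by (auto simp: H_def max_def)
    \<comment> \<open>The bound is \<open>low\<close> at the reference point \<open>x0\<close>,
      corrected by the distance from \<open>s\<close> to \<open>S x0\<close> because
      \<open>H\<close> is 1-Lipschitz in \<open>s\<close>.\<close>
    have bdd: "bdd_below (H s ` A)" for s
    proof (rule bdd_belowI2)
      fix x assume "x \<in> A"
      then show "Z k x0 - \<bar>s - S x0\<bar> \<le> H s x"
        using low[of x x0] x0 by (auto simp: H_def max_def abs_if split: if_splits)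
    qed
    have hmono: "h s \<le> h t" if "s \<le> t" for s t
      unfolding h_def using lip(2)[OF that] bdd False by (intro cINF_mono) auto
    have hlip: "h t \<le> h s + (t - s)" if "s \<le> t" for s t
    proof -
      have "h t - (t - s) \<le> h s" unfolding h_def[of s]
      proof (rule cINF_greatest[OF False])
        fix x assume x: "x \<in> A"
        have "h t \<le> H t x" unfolding h_def using bdd x by (rule cINF_lower)
        then show "h t - (t - s) \<le> H s x" using lip(1)[OF that, of x] by simp
      qed
      then show ?thesis by simp
    qed
    have hS: "h (S x) = Z k x" if "x \<in> A" for x
    proof (rule antisym)
      show "Z k x \<le> h (S x)" unfolding h_def using low that False by (intro cINF_greatest) auto
      have "h (S x) \<le> H (S x) x" unfolding h_def using bdd that by (rule cINF_lower)
      then show "h (S x) \<le> Z k x" by (simp add: H_def)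
    qed
    \<comment> \<open>At \<open>s = S x\<close> the remainder \<open>s - h s\<close> equals
      \<open>R x\<close>, exactly the argument at which \<open>g\<close> reproduces the remaining
      components.\<close>
    define f where "f i = (if i = k then h else (\<lambda>s. g i (s - h s)))" for i
    have "mono (f i)" if "i \<in> insert k F" for i
      using that hmono hlip g(1)[of i] by (fastforce simp: f_def mono_def algebra_simps)
    moreover have "(\<Sum>i\<in>insert k F. f i s) = s" for s
    proof -
      have "(\<Sum>i\<in>F. f i s) = (\<Sum>i\<in>F. g i (s - h s))"
        using insert.hyps by (intro sum.cong) (auto simp: f_def)
      then show ?thesis using insert.hyps by (simp add: g(2)) (simp add: f_def)
    qed
    moreover have "f i (S x) = Z i x" if "i \<in> insert k F" "x \<in> A" for i x
      using that hS[of x] g(3)[of i x] by (auto simp: f_def SR)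
    ultimately show ?case unfolding S_def by blast
  qed
qed

section \<open>Chord slopes and mean-preserving transfers\<close>

text \<open>The chord from \<open>y\<close> to \<open>b\<close> is the intermediary: it starts where
  the first interval ends and covers the second one up to the same right endpoint, so convexity
  compares its slope with both.\<close>

lemma convex_on_disjoint_slope_le:
  fixes f :: "real \<Rightarrow> real"
  assumes f: "convex_on UNIV f" and "x < y" "y \<le> a" "a < b"
  shows "(f y - f x) / (y - x) \<le> (f b - f a) / (b - a)"
proof -
  have flip: "(f s - f t) / (s - t) = (f t - f s) / (t - s)" for s t :: real
    using minus_divide_divide[of "f t - f s" "t - s"] by simp
  note sl = convex_on_slope_le[OF f UNIV_I UNIV_I]
  have "(f y - f x) / (y - x) \<le> (f b - f y) / (b - y)"
    using sl(1)[of x y b] sl(2)[of x y b] assms by (simp add: flip[of x] flip[of y b])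
  also have "\<dots> \<le> (f b - f a) / (b - a)"
    using sl(2)[of y a b] assms by (cases "y = a") (auto simp: flip[of y b] flip[of a b])
  finally show ?thesis .
qed

text \<open>A single slope \<open>c\<close> controls both sides: steps up to the left of
  \<open>a\<close> gain at least \<open>c\<close> per unit, and steps down to the right of
  \<open>b\<close> lose at most \<open>c\<close> per unit. When the two movements have equal total
  mass, these bounds cancel in the mean.\<close>

lemma concave_on_disjoint_slope_ge:
  fixes \<phi> :: "real \<Rightarrow> real"
  assumes conc: "concave_on UNIV \<phi>" and "a < b"
  defines "c \<equiv> (\<phi> b - \<phi> a) / (b - a)"
  shows "x \<le> y \<Longrightarrow> y \<le> a \<Longrightarrow> \<phi> y - \<phi> x \<ge> c * (y - x)"
    and "b \<le> y \<Longrightarrow> y \<le> x \<Longrightarrow> \<phi> y - \<phi> x \<ge> c * (y - x)"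
proof -
  have f: "convex_on UNIV (\<lambda>x. - \<phi> x)" using conc by (simp add: concave_on_def)
  have c': "(- \<phi> b - - \<phi> a) / (b - a) = - c"
    unfolding c_def using \<open>a < b\<close> by (simp add: field_simps)
  {
    assume xy: "x \<le> y" "y \<le> a"
    show "\<phi> y - \<phi> x \<ge> c * (y - x)"
    proof (cases "x = y")
      case False
      then have "x < y" using xy by simp
      with convex_on_disjoint_slope_le[OF f this xy(2) \<open>a < b\<close>]
      show ?thesis unfolding c' by (simp add: divide_le_eq)
    qed simp
  next
    assume xy: "b \<le> y" "y \<le> x"
    show "\<phi> y - \<phi> x \<ge> c * (y - x)"
    proof (cases "x = y")
      case False
      then have "y < x" using xy by simp
      with convex_on_disjoint_slope_le[OF f \<open>a < b\<close> xy(1) this]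
      show ?thesis unfolding c' by (simp add: le_divide_eq algebra_simps)
    qed simp
  }
qed

context prob_space
begin

lemma integrable_mono_comp_bounded:
  fixes \<phi> :: "real \<Rightarrow> real"
  assumes "mono \<phi>" "Z \<in> borel_measurable M" "\<And>\<omega>. \<omega> \<in> space M \<Longrightarrow> \<bar>Z \<omega>\<bar> \<le> C"
  shows "integrable M (\<lambda>\<omega>. \<phi> (Z \<omega>))"
proof (rule integrable_const_bound)
  show "AE \<omega> in M. norm (\<phi> (Z \<omega>)) \<le> \<bar>\<phi> C\<bar> + \<bar>\<phi> (- C)\<bar>"
  proof (rule AE_I2)
    fix \<omega> assume "\<omega> \<in> space M"
    then have "\<phi> (- C) \<le> \<phi> (Z \<omega>)" "\<phi> (Z \<omega>) \<le> \<phi> C"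
      using assms(1,3) by (auto simp: mono_def abs_le_iff minus_le_iff)
    then show "norm (\<phi> (Z \<omega>)) \<le> \<bar>\<phi> C\<bar> + \<bar>\<phi> (- C)\<bar>" by auto
  qed
  show "(\<lambda>\<omega>. \<phi> (Z \<omega>)) \<in> borel_measurable M"
    using measurable_compose[OF assms(2) borel_measurable_mono[OF assms(1)]] .
qed

text \<open>Raising low values on \<open>A\<close> and lowering high values on \<open>B\<close>
  contracts the distribution, and \<open>a * prob A = b * prob B\<close> keeps the mean. Capping
  \<open>a\<close> and \<open>b\<close> at a third of the gap leaves \<open>p + a\<close> strictly
  below \<open>q - b\<close>, so a chord of the test function fits between them.\<close>

lemma transfer_improves:
  assumes Z: "Z \<in> borel_measurable M" "\<And>\<omega>. \<omega> \<in> space M \<Longrightarrow> \<bar>Z \<omega>\<bar> \<le> C"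
    and sets: "A \<in> sets M" "B \<in> sets M" and pos: "0 < prob A" "0 < prob B"
    and A: "\<And>\<omega>. \<omega> \<in> A \<Longrightarrow> Z \<omega> \<le> p" and B: "\<And>\<omega>. \<omega> \<in> B \<Longrightarrow> q \<le> Z \<omega>"
    and ab: "0 < a" "0 < b" "a \<le> (q - p) / 3" "b \<le> (q - p) / 3" "a * prob A = b * prob B"
  defines "Z' \<equiv> (\<lambda>\<omega>. Z \<omega> + a * indicator A \<omega> - b * indicator B \<omega>)"
  shows "Z' \<in> borel_measurable M" "\<And>\<omega>. \<omega> \<in> space M \<Longrightarrow> \<bar>Z' \<omega>\<bar> \<le> C" "icv_le M Z Z'"
    "expectation (\<lambda>\<omega>. (Z' \<omega>)\<^sup>2) < expectation (\<lambda>\<omega>. (Z \<omega>)\<^sup>2)"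
proof -
  have pq: "p < q" using ab by simp
  have disj: "A \<inter> B = {}" using A B pq by fastforce
  have sub: "A \<subseteq> space M" "B \<subseteq> space M" using sets sets.sets_into_space by auto
  have "A \<noteq> {}" "B \<noteq> {}" using pos by auto
  \<comment> \<open>These points serve only to place the thresholds \<open>p\<close> and
    \<open>q\<close> inside the box: raised values stay below \<open>q\<close> and lowered ones
    above \<open>p\<close>, so the bound \<open>C\<close> survives the transfer.\<close>
  then obtain u v where u: "u \<in> A" and v: "v \<in> B" by blast
  have pC: "- C \<le> p" using A[OF u] Z(2)[of u] u sub by fastforce
  have qC: "q \<le> C" using B[OF v] Z(2)[of v] v sub by fastforce
  show m: "Z' \<in> borel_measurable M" unfolding Z'_def using Z(1) sets by measurable
  have eqA: "Z' \<omega> = Z \<omega> + a" if "\<omega> \<in> A" for \<omega>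
    using that disj by (auto simp: Z'_def indicator_def)
  have eqB: "Z' \<omega> = Z \<omega> - b" if "\<omega> \<in> B" for \<omega>
    using that disj by (auto simp: Z'_def indicator_def)
  have eqN: "Z' \<omega> = Z \<omega>" if "\<omega> \<notin> A" "\<omega> \<notin> B" for \<omega>
    using that by (auto simp: Z'_def)
  show bd: "\<bar>Z' \<omega>\<bar> \<le> C" if "\<omega> \<in> space M" for \<omega>
    using Z(2)[OF that] A[of \<omega>] B[of \<omega>] eqA[of \<omega>] eqB[of \<omega>] eqN[of \<omega>] pC qC ab
    by (cases "\<omega> \<in> A"; cases "\<omega> \<in> B") (auto simp: abs_le_iff)
  \<comment> \<open>The weights \<open>r\<close> and \<open>s\<close> are left free: both are the
    chord slope in the argument for the concave order, while for the second moment they differ and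
    the sign of \<open>r - s\<close> gives the strict decrease.\<close>
  have intI: "integrable M (\<lambda>\<omega>. r * (a * indicator A \<omega>) - s * (b * indicator B \<omega>))" for r s :: real
    using sets by (intro Bochner_Integration.integrable_diff integrable_mult_right integrable_real_indicator) (auto simp: emeasure_eq_measure)
  have evI: "expectation (\<lambda>\<omega>. r * (a * indicator A \<omega>) - s * (b * indicator B \<omega>)) = (r - s) * (a * prob A)"
    for r s :: real
  proof -
    have i: "integrable M (\<lambda>\<omega>. r * (a * indicator A \<omega>))" "integrable M (\<lambda>\<omega>. s * (b * indicator B \<omega>))"
      using intI[of r 0] intI[of 0 "- s"] by simp_all
    have "expectation (\<lambda>\<omega>. r * (a * indicator A \<omega>) - s * (b * indicator B \<omega>)) = r * (a * prob A) - s * (b * prob B)"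
      using sets by (subst Bochner_Integration.integral_diff[OF i]) auto
    then show ?thesis using ab(5) by (simp add: algebra_simps)
  qed
  show "icv_le M Z Z'" unfolding icv_le_def
  proof (intro allI impI)
    fix \<phi> :: "real \<Rightarrow> real" assume phi: "mono \<phi> \<and> concave_on UNIV \<phi>"
    \<comment> \<open>after the transfer Z' is at most x on A and at least y on B, so the slope c of \<open>\<phi>\<close>
      between x and y bounds the change on both sides\<close>
    define x y c where "x = p + a" and "y = q - b" and "c = (\<phi> y - \<phi> x) / (y - x)"
    have "x < y" using ab by (simp add: x_def y_def)
    note tr = concave_on_disjoint_slope_ge[OF conjunct2[OF phi] this, folded c_def]
    have ge: "c * (a * indicator A \<omega>) - c * (b * indicator B \<omega>) \<le> \<phi> (Z' \<omega>) - \<phi> (Z \<omega>)" for \<omega>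
      using tr(1)[of "Z \<omega>" "Z' \<omega>"] tr(2)[of "Z' \<omega>" "Z \<omega>"] A[of \<omega>] B[of \<omega>] ab eqA[of \<omega>] eqB[of \<omega>] eqN[of \<omega>] disj
      by (cases "\<omega> \<in> A"; cases "\<omega> \<in> B") (auto simp: x_def y_def)
    have i: "integrable M (\<lambda>\<omega>. \<phi> (Z \<omega>))" "integrable M (\<lambda>\<omega>. \<phi> (Z' \<omega>))"
      using integrable_mono_comp_bounded phi Z m bd by blast+
    have "expectation (\<lambda>\<omega>. c * (a * indicator A \<omega>) - c * (b * indicator B \<omega>))
        \<le> expectation (\<lambda>\<omega>. \<phi> (Z' \<omega>) - \<phi> (Z \<omega>))"
      using ge i intI by (intro integral_mono) auto
    then show "expectation (\<lambda>\<omega>. \<phi> (Z \<omega>)) \<le> expectation (\<lambda>\<omega>. \<phi> (Z' \<omega>))"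
      using i evI[of c c] by simp
  qed
  have i: "integrable M (\<lambda>\<omega>. (Z \<omega>)\<^sup>2)" "integrable M (\<lambda>\<omega>. (Z' \<omega>)\<^sup>2)"
  proof -
    have "x\<^sup>2 \<le> C\<^sup>2" if "\<bar>x\<bar> \<le> C" for x :: real using that by (intro power2_mono) linarith
    then show "integrable M (\<lambda>\<omega>. (Z \<omega>)\<^sup>2)" "integrable M (\<lambda>\<omega>. (Z' \<omega>)\<^sup>2)"
      using Z m bd by (auto intro!: integrable_const_bound[where B="C\<^sup>2"] AE_I2)
  qed
  \<comment> \<open>After expanding the squares, \<open>Z\<close> enters linearly and can be
    replaced by its threshold, \<open>p\<close> on \<open>A\<close> and \<open>q\<close> on
    \<open>B\<close>.\<close>
  have le: "(Z' \<omega>)\<^sup>2 - (Z \<omega>)\<^sup>2 \<le> (2 * p + a) * (a * indicator A \<omega>) - (2 * q - b) * (b * indicator B \<omega>)" for \<omega>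
  proof -
    have "(Z \<omega> + a)\<^sup>2 - (Z \<omega>)\<^sup>2 \<le> (2 * p + a) * a" if "\<omega> \<in> A"
      using mult_right_mono[OF A[OF that], of "2 * a"] ab by (simp add: power2_eq_square algebra_simps)
    moreover have "(Z \<omega> - b)\<^sup>2 - (Z \<omega>)\<^sup>2 \<le> - ((2 * q - b) * b)" if "\<omega> \<in> B"
      using mult_right_mono[OF B[OF that], of "2 * b"] ab by (simp add: power2_eq_square algebra_simps)
    ultimately show ?thesis
      using eqA[of \<omega>] eqB[of \<omega>] eqN[of \<omega>] disj by (cases "\<omega> \<in> A"; cases "\<omega> \<in> B") auto
  qed
  have "expectation (\<lambda>\<omega>. (Z' \<omega>)\<^sup>2 - (Z \<omega>)\<^sup>2)
      \<le> expectation (\<lambda>\<omega>. (2 * p + a) * (a * indicator A \<omega>) - (2 * q - b) * (b * indicator B \<omega>))"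
    using le i intI by (intro integral_mono) auto
  \<comment> \<open>The first factor is \<open>a + b - 2 * (q - p)\<close>, which is negative since
    \<open>a + b\<close> is at most two thirds of \<open>q - p\<close>.\<close>
  moreover have "(2 * p + a - (2 * q - b)) * (a * prob A) < 0"
    using ab pos pq by (intro mult_neg_pos) auto
  ultimately show "expectation (\<lambda>\<omega>. (Z' \<omega>)\<^sup>2) < expectation (\<lambda>\<omega>. (Z \<omega>)\<^sup>2)"
    using i evI[of "2 * p + a" "2 * q - b"] by simp
qed

section \<open>Existence of an improvement of least energy\<close>

text \<open>The geometric rate makes the L1 norms of the increments summable. Hence the sum of their
  absolute values has finite expectation, is finite almost surely, and the telescoping series
  converges absolutely.\<close>

lemma AE_Cauchy_of_fast_L2:
  fixes f :: "nat \<Rightarrow> 'a \<Rightarrow> real"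
  assumes f: "\<And>k. f k \<in> borel_measurable M"
    and int: "\<And>k. integrable M (\<lambda>\<omega>. (f (Suc k) \<omega> - f k \<omega>)\<^sup>2)"
    and fast: "\<And>k. expectation (\<lambda>\<omega>. (f (Suc k) \<omega> - f k \<omega>)\<^sup>2) \<le> (1/16)^k"
  shows "AE \<omega> in M. Cauchy (\<lambda>k. f k \<omega>)"
proof -
  define d where "d k \<omega> = f (Suc k) \<omega> - f k \<omega>" for k \<omega>
  have d[measurable]: "d k \<in> borel_measurable M" for k
    unfolding d_def using f by measurable
  \<comment> \<open>The weights \<open>4^k\<close> and \<open>(1/4)^k\<close> balance the two terms:
    for a second moment of at most \<open>(1/16)^k\<close>, each has expectation at most
    \<open>(1/4)^k\<close>.\<close>
  have int': "integrable M (\<lambda>\<omega>. (4^k * (d k \<omega>)\<^sup>2 + (1/4)^k) / 2)" for k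
    using int[of k] unfolding d_def by simp
  have bound: "(\<integral>\<^sup>+\<omega>. ennreal \<bar>d k \<omega>\<bar> \<partial>M) \<le> ennreal ((1/4)^k)" for k
  proof -
    \<comment> \<open>AM-GM, in place of the Cauchy-Schwarz inequality\<close>
    have le: "\<bar>d k \<omega>\<bar> \<le> (4^k * (d k \<omega>)\<^sup>2 + (1/4)^k) / 2" for \<omega>
    proof -
      have "0 \<le> (2^k * \<bar>d k \<omega>\<bar> - (1/2)^k)\<^sup>2" by simp
      also have "\<dots> = 4^k * (d k \<omega>)\<^sup>2 + (1/4)^k - 2 * \<bar>d k \<omega>\<bar>"
      proof -
        have "(4::real)^k = 2^k * 2^k" by (simp flip: power_mult_distrib)
        then show ?thesis by (simp add: power2_eq_square power_divide field_simps)
      qed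
      finally show ?thesis by simp
    qed
    have "(\<integral>\<^sup>+\<omega>. ennreal \<bar>d k \<omega>\<bar> \<partial>M) \<le> (\<integral>\<^sup>+\<omega>. ennreal ((4^k * (d k \<omega>)\<^sup>2 + (1/4)^k) / 2) \<partial>M)"
      using le by (intro nn_integral_mono ennreal_leI)
    also have "\<dots> = ennreal (expectation (\<lambda>\<omega>. (4^k * (d k \<omega>)\<^sup>2 + (1/4)^k) / 2))"
      using int'[of k] by (intro nn_integral_eq_integral) auto
    also have "expectation (\<lambda>\<omega>. (4^k * (d k \<omega>)\<^sup>2 + (1/4)^k) / 2)
        = (4^k * expectation (\<lambda>\<omega>. (d k \<omega>)\<^sup>2) + (1/4)^k) / 2"
      using int[of k] by (simp add: prob_space d_def)
    also have "\<dots> \<le> (4^k * (1/16)^k + (1/4)^k) / 2"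
      using fast[of k] by (simp add: d_def)
    also have "\<dots> = (1/4)^k" by (simp flip: power_mult_distrib)
    finally show ?thesis by (simp add: ennreal_leI)
  qed
  have "(\<integral>\<^sup>+\<omega>. (\<Sum>k. ennreal \<bar>d k \<omega>\<bar>) \<partial>M) = (\<Sum>k. \<integral>\<^sup>+\<omega>. ennreal \<bar>d k \<omega>\<bar> \<partial>M)"
    by (intro nn_integral_suminf) measurable
  also have "\<dots> \<le> (\<Sum>k. ennreal ((1/4)^k))"
    using bound by (intro suminf_le) auto
  also have "\<dots> = ennreal (\<Sum>k. (1/4)^k)"
    by (intro suminf_ennreal2) (auto intro!: summable_geometric)
  finally have "(\<integral>\<^sup>+\<omega>. (\<Sum>k. ennreal \<bar>d k \<omega>\<bar>) \<partial>M) \<noteq> \<infinity>"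
    by (auto simp: top_unique)
  then have "AE \<omega> in M. (\<Sum>k. ennreal \<bar>d k \<omega>\<bar>) \<noteq> \<infinity>"
    by (intro nn_integral_PInf_AE) auto
  then show ?thesis
  proof (rule AE_mp, intro AE_I2 impI)
    fix \<omega> assume "(\<Sum>k. ennreal \<bar>d k \<omega>\<bar>) \<noteq> \<infinity>"
    then have "summable (\<lambda>k. \<bar>d k \<omega>\<bar>)" by (intro summable_suminf_not_top) auto
    then have "summable (\<lambda>k. d k \<omega>)" by (rule summable_rabs_cancel)
    then have "convergent (\<lambda>n. \<Sum>k<n. d k \<omega>)" by (simp add: summable_iff_convergent)
    then have "convergent (\<lambda>n. f n \<omega> - f 0 \<omega>)" unfolding d_def by (simp add: sum_lessThan_telescope[of "\<lambda>k. f k \<omega>"])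
    then have "convergent (\<lambda>n. (f n \<omega> - f 0 \<omega>) + f 0 \<omega>)" by (intro convergent_add convergent_const)
    then show "Cauchy (\<lambda>k. f k \<omega>)" by (simp add: convergent_Cauchy)
  qed
qed

text \<open>All constraints survive midpoints and, after repair on a null set, almost sure limits.
  The common bound \<open>C\<close> supplies the dominating constants, and the sum is fixed at every
  point, as in \<open>allocs\<close>.\<close>

definition improvements :: "'i set \<Rightarrow> real \<Rightarrow> ('i \<Rightarrow> 'a \<Rightarrow> real) \<Rightarrow> ('i \<Rightarrow> 'a \<Rightarrow> real) set" where
  "improvements I C Y = {Z. (\<forall>i\<in>I. Z i \<in> borel_measurable M \<and>
      (\<forall>\<omega>\<in>space M. \<bar>Z i \<omega>\<bar> \<le> C) \<and> icv_le M (Y i) (Z i)) \<and>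
      (\<forall>\<omega>\<in>space M. (\<Sum>i\<in>I. Z i \<omega>) = (\<Sum>i\<in>I. Y i \<omega>))}"

text \<open>This is the squared norm of the family in a product of L2 spaces, which makes the
  parallelogram law available.\<close>

definition energy :: "'i set \<Rightarrow> ('i \<Rightarrow> 'a \<Rightarrow> real) \<Rightarrow> real" where
  "energy I Z = (\<Sum>i\<in>I. expectation (\<lambda>\<omega>. (Z i \<omega>)\<^sup>2))"

lemma improvementsD:
  assumes "Z \<in> improvements I C Y"
  shows "i \<in> I \<Longrightarrow> Z i \<in> borel_measurable M"
    and "i \<in> I \<Longrightarrow> \<omega> \<in> space M \<Longrightarrow> \<bar>Z i \<omega>\<bar> \<le> C"
    and "i \<in> I \<Longrightarrow> icv_le M (Y i) (Z i)"
    and "\<omega> \<in> space M \<Longrightarrow> (\<Sum>i\<in>I. Z i \<omega>) = (\<Sum>i\<in>I. Y i \<omega>)"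
  using assms unfolding improvements_def by auto

lemma integrable_mult_bounded:
  fixes f g :: "'a \<Rightarrow> real"
  assumes "f \<in> borel_measurable M" "\<And>\<omega>. \<omega> \<in> space M \<Longrightarrow> \<bar>f \<omega>\<bar> \<le> C"
    "g \<in> borel_measurable M" "\<And>\<omega>. \<omega> \<in> space M \<Longrightarrow> \<bar>g \<omega>\<bar> \<le> D"
  shows "integrable M (\<lambda>\<omega>. f \<omega> * g \<omega>)"
proof (rule integrable_const_bound)
  show "AE \<omega> in M. norm (f \<omega> * g \<omega>) \<le> C * D"
    using assms(2,4) by (intro AE_I2) (force simp: abs_mult intro!: mult_mono intro: order_trans[OF abs_ge_zero])
qed (use assms in measurable)

text \<open>Concavity of each test function keeps the dominance over \<open>Y\<close> under
  averaging. Midpoints are the only convex combinations that the parallelogram argument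
  uses.\<close>

lemma improvements_midpoint:
  assumes Z: "Z \<in> improvements I C Y" and W: "W \<in> improvements I C Y"
  shows "(\<lambda>i \<omega>. (Z i \<omega> + W i \<omega>) / 2) \<in> improvements I C Y"
proof -
  have "icv_le M (Y i) (\<lambda>\<omega>. (Z i \<omega> + W i \<omega>) / 2)" if i: "i \<in> I" for i
    unfolding icv_le_def
  proof (intro allI impI)
    fix \<phi> :: "real \<Rightarrow> real" assume phi: "mono \<phi> \<and> concave_on UNIV \<phi>"
    note ZW = improvementsD[OF Z] improvementsD[OF W]
    have mid: "\<phi> x / 2 + \<phi> y / 2 \<le> \<phi> ((x + y) / 2)" for x y
      using phi concave_onD[of UNIV \<phi> "1/2" x y] by (simp add: add_divide_distrib)
    have ints: "integrable M (\<lambda>\<omega>. \<phi> (Z i \<omega>))" "integrable M (\<lambda>\<omega>. \<phi> (W i \<omega>))"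
      using integrable_mono_comp_bounded[OF conjunct1[OF phi], of _ C] ZW(1,2,5,6) i by blast+
    have intm: "integrable M (\<lambda>\<omega>. \<phi> ((Z i \<omega> + W i \<omega>) / 2))"
    proof (rule integrable_mono_comp_bounded[where \<phi>=\<phi> and C=C and Z="\<lambda>\<omega>. (Z i \<omega> + W i \<omega>) / 2"])
      show "\<bar>(Z i \<omega> + W i \<omega>) / 2\<bar> \<le> C" if "\<omega> \<in> space M" for \<omega>
        using ZW(2)[OF i that] ZW(6)[OF i that] by (auto simp: abs_le_iff)
    qed (use phi ZW i in auto)
    have "expectation (\<lambda>\<omega>. \<phi> (Y i \<omega>))
        \<le> expectation (\<lambda>\<omega>. \<phi> (Z i \<omega>)) / 2 + expectation (\<lambda>\<omega>. \<phi> (W i \<omega>)) / 2"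
      using ZW(3)[OF i] ZW(7)[OF i] phi unfolding icv_le_def by fastforce
    also have "\<dots> = expectation (\<lambda>\<omega>. \<phi> (Z i \<omega>) / 2 + \<phi> (W i \<omega>) / 2)"
      using ints by simp
    also have "\<dots> \<le> expectation (\<lambda>\<omega>. \<phi> ((Z i \<omega> + W i \<omega>) / 2))"
      using ints intm mid by (intro integral_mono) auto
    finally show "expectation (\<lambda>\<omega>. \<phi> (Y i \<omega>)) \<le> expectation (\<lambda>\<omega>. \<phi> ((Z i \<omega> + W i \<omega>) / 2))" .
  qed
  moreover have "(\<Sum>i\<in>I. (Z i \<omega> + W i \<omega>) / 2) = (\<Sum>i\<in>I. Y i \<omega>)" if "\<omega> \<in> space M" for \<omega>
    using improvementsD(4)[OF Z that] improvementsD(4)[OF W that]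
    by (simp add: sum.distrib flip: sum_divide_distrib)
  moreover have "\<bar>(Z i \<omega> + W i \<omega>) / 2\<bar> \<le> C" if "i \<in> I" "\<omega> \<in> space M" for i \<omega>
    using improvementsD(2)[OF Z that] improvementsD(2)[OF W that] by (auto simp: abs_le_iff)
  ultimately show ?thesis
    using improvementsD(1)[OF Z] improvementsD(1)[OF W] unfolding improvements_def by auto
qed

text \<open>A midpoint cannot have energy below the infimum, so this identity turns near-minimality
  of two improvements into closeness in L2. Membership in \<open>improvements\<close> provides the
  bounds that make all products integrable.\<close>

lemma energy_parallelogram:
  assumes Z: "Z \<in> improvements I C Y" and W: "W \<in> improvements I C Y"
  shows "energy I (\<lambda>i \<omega>. Z i \<omega> - W i \<omega>)
    = 2 * energy I Z + 2 * energy I W - 4 * energy I (\<lambda>i \<omega>. (Z i \<omega> + W i \<omega>) / 2)"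
proof -
  have "expectation (\<lambda>\<omega>. (Z i \<omega> - W i \<omega>)\<^sup>2) = 2 * expectation (\<lambda>\<omega>. (Z i \<omega>)\<^sup>2)
      + 2 * expectation (\<lambda>\<omega>. (W i \<omega>)\<^sup>2) - 4 * expectation (\<lambda>\<omega>. ((Z i \<omega> + W i \<omega>) / 2)\<^sup>2)"
    if i: "i \<in> I" for i
  proof -
    note ZW = improvementsD(1,2)[OF Z i] improvementsD(1,2)[OF W i]
    have ints: "integrable M (\<lambda>\<omega>. Z i \<omega> * Z i \<omega>)" "integrable M (\<lambda>\<omega>. W i \<omega> * W i \<omega>)"
      "integrable M (\<lambda>\<omega>. Z i \<omega> * W i \<omega>)"
      using ZW by (auto intro!: integrable_mult_bounded[where C=C and D=C])
    have "expectation (\<lambda>\<omega>. (Z i \<omega> - W i \<omega>)\<^sup>2)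
        = expectation (\<lambda>\<omega>. Z i \<omega> * Z i \<omega> + W i \<omega> * W i \<omega> - 2 * (Z i \<omega> * W i \<omega>))"
      by (intro Bochner_Integration.integral_cong) (auto simp: power2_eq_square algebra_simps)
    moreover have "expectation (\<lambda>\<omega>. ((Z i \<omega> + W i \<omega>) / 2)\<^sup>2)
        = expectation (\<lambda>\<omega>. (Z i \<omega> * Z i \<omega> + W i \<omega> * W i \<omega> + 2 * (Z i \<omega> * W i \<omega>)) / 4)"
      by (intro Bochner_Integration.integral_cong) (auto simp: power2_eq_square field_simps)
    ultimately show ?thesis using ints by (simp add: power2_eq_square) (simp add: field_simps)
  qed
  then show ?thesis
    unfolding energy_def by (simp add: sum.distrib sum_subtractf sum_distrib_left)
qed

text \<open>Because everything stays in the box, dominated convergence carries the expectations of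
  continuous functions to the limit; this preserves the order constraints and gives convergence of
  the energies.\<close>

lemma improvements_AE_limit:
  assumes I: "finite I"
    and Y: "\<And>i. i \<in> I \<Longrightarrow> Y i \<in> borel_measurable M"
      "\<And>i \<omega>. i \<in> I \<Longrightarrow> \<omega> \<in> space M \<Longrightarrow> \<bar>Y i \<omega>\<bar> \<le> C"
    and W: "\<And>k. W k \<in> improvements I C Y"
    and ae: "\<And>i. i \<in> I \<Longrightarrow> AE \<omega> in M. Cauchy (\<lambda>k. W k i \<omega>)"
  shows "\<exists>Z\<in>improvements I C Y. (\<lambda>k. energy I (W k)) \<longlonglongrightarrow> energy I Z"
proof -
  note W' = improvementsD[OF W]
  define G where "G = {\<omega>\<in>space M. \<forall>i\<in>I. Cauchy (\<lambda>k. W k i \<omega>)}"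
  \<comment> \<open>Where some component fails to converge, \<open>Y\<close> is the default value:
    it satisfies the box and sum constraints at every point.\<close>
  define Z where "Z i \<omega> = (if \<omega> \<in> G then lim (\<lambda>k. W k i \<omega>) else Y i \<omega>)" for i \<omega>
  have G: "G \<in> sets M"
    unfolding G_def using I W'(1) by (intro sets.sets_Collect_finite_All sets_Collect_Cauchy) auto
  have aeG: "AE \<omega> in M. \<omega> \<in> G"
  proof -
    have "AE \<omega> in M. \<forall>i\<in>I. Cauchy (\<lambda>k. W k i \<omega>)" using I ae by (intro AE_finite_allI) auto
    with AE_space show ?thesis by eventually_elim (simp add: G_def)
  qed
  have lim: "(\<lambda>k. W k i \<omega>) \<longlonglongrightarrow> Z i \<omega>" if "\<omega> \<in> G" "i \<in> I" for i \<omega>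
    using that unfolding G_def Z_def
    by (auto simp: Cauchy_convergent_iff convergent_LIMSEQ_iff G_def)
  have GM: "\<omega> \<in> space M" if "\<omega> \<in> G" for \<omega> using that by (simp add: G_def)
  have Zm: "Z i \<in> borel_measurable M" if "i \<in> I" for i
    unfolding Z_def using G Y(1)[OF that] W'(1)[OF that] by measurable
  have Zb: "\<bar>Z i \<omega>\<bar> \<le> C" if "i \<in> I" "\<omega> \<in> space M" for i \<omega>
  proof (cases "\<omega> \<in> G")
    case True
    show ?thesis
      using tendsto_rabs[OF lim[OF True that(1)]] W'(2)[OF that]
      by (intro LIMSEQ_le_const2) auto
  qed (use Y(2) that in \<open>simp add: Z_def\<close>)
  \<comment> \<open>A general continuous function is used so that one argument covers both the
    concave test functions and the square.\<close>
  have expl: "(\<lambda>k. expectation (\<lambda>\<omega>. \<psi> (W k i \<omega>))) \<longlonglongrightarrow> expectation (\<lambda>\<omega>. \<psi> (Z i \<omega>))"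
    if i: "i \<in> I" and psi: "continuous_on UNIV \<psi>" for i and \<psi> :: "real \<Rightarrow> real"
  proof -
    have "bounded (\<psi> ` {- C..C})"
      using psi by (intro compact_imp_bounded compact_continuous_image) (auto intro: continuous_on_subset)
    then obtain B where B: "\<And>x. x \<in> {-C..C} \<Longrightarrow> \<bar>\<psi> x\<bar> \<le> B" unfolding bounded_iff by fastforce
    have meas[measurable]: "\<psi> \<in> borel_measurable borel" using psi by (rule borel_measurable_continuous_onI)
    show ?thesis
    proof (rule integral_dominated_convergence[where w = "\<lambda>_. B"])
      show "(\<lambda>\<omega>. \<psi> (Z i \<omega>)) \<in> borel_measurable M" using Zm[OF i] by measurable
      show "(\<lambda>\<omega>. \<psi> (W k i \<omega>)) \<in> borel_measurable M" for k using W'(1)[OF i, of k] by measurable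
      show "AE \<omega> in M. (\<lambda>k. \<psi> (W k i \<omega>)) \<longlonglongrightarrow> \<psi> (Z i \<omega>)"
        using aeG
      proof eventually_elim
        case (elim \<omega>)
        have "isCont \<psi> (Z i \<omega>)" using psi by (simp add: continuous_on_eq_continuous_at)
        then show ?case using lim[OF elim i] by (rule isCont_tendsto_compose)
      qed
      show "AE \<omega> in M. norm (\<psi> (W k i \<omega>)) \<le> B" for k
      proof (rule AE_I2)
        fix \<omega> assume "\<omega> \<in> space M"
        then have "W k i \<omega> \<in> {-C..C}" using W'(2)[OF i, of \<omega> k] by (simp add: abs_le_iff minus_le_iff)
        then show "norm (\<psi> (W k i \<omega>)) \<le> B" using B by simp
      qed
    qed simp
  qed
  have "icv_le M (Y i) (Z i)" if i: "i \<in> I" for i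
    unfolding icv_le_def
  proof (intro allI impI)
    fix \<phi> :: "real \<Rightarrow> real" assume phi: "mono \<phi> \<and> concave_on UNIV \<phi>"
    have "continuous_on UNIV (\<lambda>x. - \<phi> x)"
      using phi by (intro convex_on_continuous) (auto simp: concave_on_def)
    from continuous_on_minus[OF this] have "continuous_on UNIV \<phi>" by simp
    from expl[OF i this] show "expectation (\<lambda>\<omega>. \<phi> (Y i \<omega>)) \<le> expectation (\<lambda>\<omega>. \<phi> (Z i \<omega>))"
      using W'(3)[OF i] phi unfolding icv_le_def by (intro LIMSEQ_le_const) auto
  qed
  moreover have "(\<Sum>i\<in>I. Z i \<omega>) = (\<Sum>i\<in>I. Y i \<omega>)" if "\<omega> \<in> space M" for \<omega>
  proof (cases "\<omega> \<in> G")
    case True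
    have "(\<lambda>k. \<Sum>i\<in>I. W k i \<omega>) \<longlonglongrightarrow> (\<Sum>i\<in>I. Z i \<omega>)"
      using lim[OF True] by (intro tendsto_sum)
    then show ?thesis using W'(4)[OF that] by (simp add: LIMSEQ_const_iff)
  qed (simp add: Z_def)
  ultimately have "Z \<in> improvements I C Y"
    unfolding improvements_def using Zm Zb by auto
  moreover have "(\<lambda>k. energy I (W k)) \<longlonglongrightarrow> energy I Z"
  proof -
    have "continuous_on UNIV (\<lambda>x::real. x\<^sup>2)" by (intro continuous_intros)
    from expl[OF _ this] show ?thesis unfolding energy_def by (intro tendsto_sum)
  qed
  ultimately show ?thesis by blast
qed

text \<open>As in the Hilbert space projection theorem, a minimizing sequence is Cauchy by the
  parallelogram law. Choosing it with geometric speed gives almost sure convergence without passing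
  to a subsequence.\<close>

lemma energy_minimizer_exists:
  assumes I: "finite I"
    and Y: "\<And>i. i \<in> I \<Longrightarrow> Y i \<in> borel_measurable M"
      "\<And>i \<omega>. i \<in> I \<Longrightarrow> \<omega> \<in> space M \<Longrightarrow> \<bar>Y i \<omega>\<bar> \<le> C"
  shows "\<exists>Z\<in>improvements I C Y. \<forall>W\<in>improvements I C Y. energy I Z \<le> energy I W"
proof -
  let ?D = "improvements I C Y"
  have "Y \<in> ?D" using Y by (auto simp: improvements_def icv_le_def)
  then have ne: "energy I ` ?D \<noteq> {}" by blast
  have bdd: "bdd_below (energy I ` ?D)"
    by (rule bdd_belowI2[of _ 0]) (auto simp: energy_def intro!: sum_nonneg)
  define m where "m = Inf (energy I ` ?D)"
  have m: "m \<le> energy I W" if "W \<in> ?D" for W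
    unfolding m_def using bdd that by (intro cInf_lower) auto
  \<comment> \<open>With excess below \<open>(1/16)^k / 4\<close>, the parallelogram law bounds the
    squared distance of consecutive terms by \<open>(1/16)^k\<close>, the rate required by
    \<open>AE_Cauchy_of_fast_L2\<close>.\<close>
  have "\<exists>W\<in>?D. energy I W < m + (1/16)^k / 4" for k :: nat
    using cInf_lessD[OF ne, of "m + (1/16)^k / 4"] unfolding m_def by auto
  then obtain W where W: "\<And>k. W k \<in> ?D" "\<And>k. energy I (W k) < m + (1/16)^k / 4" by metis
  have "AE \<omega> in M. Cauchy (\<lambda>k. W k i \<omega>)" if i: "i \<in> I" for i
  proof (rule AE_Cauchy_of_fast_L2)
    fix k
    note Wk = improvementsD(1,2)[OF W(1) i]
    show "W k i \<in> borel_measurable M" by (rule Wk)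
    have "\<bar>W (Suc k) i \<omega> - W k i \<omega>\<bar> \<le> 2 * C" if "\<omega> \<in> space M" for \<omega>
      using Wk(2)[OF that, of k] Wk(2)[OF that, of "Suc k"] by linarith
    then show "integrable M (\<lambda>\<omega>. (W (Suc k) i \<omega> - W k i \<omega>)\<^sup>2)"
      unfolding power2_eq_square using Wk(1) by (intro integrable_mult_bounded) auto
    have "expectation (\<lambda>\<omega>. (W (Suc k) i \<omega> - W k i \<omega>)\<^sup>2) \<le> energy I (\<lambda>i \<omega>. W (Suc k) i \<omega> - W k i \<omega>)"
      unfolding energy_def using I i
      by (intro member_le_sum[where f="\<lambda>i. expectation (\<lambda>\<omega>. (W (Suc k) i \<omega> - W k i \<omega>)\<^sup>2)"]) auto
    also have "\<dots> = 2 * energy I (W (Suc k)) + 2 * energy I (W k)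
        - 4 * energy I (\<lambda>i \<omega>. (W (Suc k) i \<omega> + W k i \<omega>) / 2)"
      by (rule energy_parallelogram[OF W(1) W(1)])
    also have "\<dots> \<le> (1/16)^Suc k / 2 + (1/16)^k / 2"
      using W(2)[of k] W(2)[of "Suc k"] m[OF improvements_midpoint[OF W(1) W(1)], of "Suc k" k] by linarith
    also have "\<dots> \<le> (1/16)^k" by simp
    finally show "expectation (\<lambda>\<omega>. (W (Suc k) i \<omega> - W k i \<omega>)\<^sup>2) \<le> (1/16)^k" .
  qed
  from improvements_AE_limit[OF I Y W(1) this]
  obtain Z where Z: "Z \<in> ?D" "(\<lambda>k. energy I (W k)) \<longlonglongrightarrow> energy I Z" by blast
  have "(\<lambda>k. m + (1/16)^k / 4) \<longlonglongrightarrow> m + 0 / 4"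
    by (intro tendsto_intros LIMSEQ_realpow_zero) auto
  with Z(2) have "energy I Z \<le> m + 0 / 4"
    using W(2) by (intro LIMSEQ_le[OF Z(2)]) (auto intro: less_imp_le)
  then have "energy I Z \<le> energy I W" if "W \<in> ?D" for W using m[OF that] by simp
  then show ?thesis using Z(1) by blast
qed

section \<open>Comonotonicity of the minimizer\<close>

lemma icv_le_trans: "icv_le M Z1 Z2 \<Longrightarrow> icv_le M Z2 Z3 \<Longrightarrow> icv_le M Z1 Z3"
  unfolding icv_le_def by (meson order_trans)

text \<open>If both sets had positive probability, agents \<open>i\<close> and \<open>j\<close>
  could trade: \<open>i\<close> receives where it is low and \<open>j\<close> is high, and pays
  where the positions are reversed. Fixed gaps between the levels allow transfers of constant size
  on each set.\<close>

lemma energy_minimizer_no_crossing: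
  assumes I: "finite I" "i \<in> I" "j \<in> I" and Z: "Z \<in> improvements I C Y"
    and min: "\<And>W. W \<in> improvements I C Y \<Longrightarrow> energy I Z \<le> energy I W"
    and pq: "p < p'" "q < q'"
  shows "prob {\<omega>\<in>space M. Z i \<omega> \<le> p \<and> q' \<le> Z j \<omega>} = 0 \<or>
    prob {\<omega>\<in>space M. Z j \<omega> \<le> q \<and> p' \<le> Z i \<omega>} = 0"
proof (rule ccontr)
  define A where "A = {\<omega>\<in>space M. Z i \<omega> \<le> p \<and> q' \<le> Z j \<omega>}"
  define B where "B = {\<omega>\<in>space M. Z j \<omega> \<le> q \<and> p' \<le> Z i \<omega>}"
  assume "\<not> ?thesis"
  then have pos: "0 < prob A" "0 < prob B"
    unfolding A_def B_def by (auto simp: zero_less_measure_iff)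
  note ZD = improvementsD[OF Z]
  have sets: "A \<in> sets M" "B \<in> sets M"
    unfolding A_def B_def using ZD(1)[OF I(2)] ZD(1)[OF I(3)] by measurable
  have "A \<noteq> {}" "B \<noteq> {}" using pos by auto
  \<comment> \<open>For \<open>i = j\<close> a point of \<open>A\<close> would give
    \<open>q' \<le> p\<close> and a point of \<open>B\<close> would give \<open>p' \<le> q\<close>,
    which is impossible with \<open>p < p'\<close> and \<open>q < q'\<close>.\<close>
  then have ij: "i \<noteq> j" using pq by (auto simp: A_def B_def)
  define \<delta> where "\<delta> = min (p' - p) (q' - q) / 3"
  have \<delta>: "0 < \<delta>" "\<delta> \<le> (p' - p) / 3" "\<delta> \<le> (q' - q) / 3" using pq by (auto simp: \<delta>_def)
  \<comment> \<open>Each amount is scaled by the probability of the other set, which equalizes the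
    transferred masses; probabilities are at most 1, so neither amount exceeds \<delta>.\<close>
  define a b where "a = \<delta> * prob B" and "b = \<delta> * prob A"
  have "a \<le> \<delta>" "b \<le> \<delta>" using \<delta>(1) by (auto simp: a_def b_def mult_left_le)
  moreover have "0 < a" "0 < b" "a * prob A = b * prob B"
    using pos \<delta>(1) by (auto simp: a_def b_def)
  ultimately have ab: "0 < a" "0 < b" "a \<le> (p' - p) / 3" "b \<le> (p' - p) / 3" "a \<le> (q' - q) / 3" "b \<le> (q' - q) / 3"
    "a * prob A = b * prob B"
    using \<delta>(2,3) by auto
  \<comment> \<open>The same \<open>D\<close> is added to agent \<open>i\<close> and taken from
    agent \<open>j\<close>, so the sum is unchanged; for \<open>j\<close> the sets \<open>A\<close>
    and \<open>B\<close> exchange roles.\<close>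
  define D where "D \<omega> = a * indicator A \<omega> - b * indicator B \<omega>" for \<omega>
  define W where "W k \<omega> = Z k \<omega> + (if k = i then D \<omega> else 0) - (if k = j then D \<omega> else 0)" for k \<omega>
  have Wi: "W i = (\<lambda>\<omega>. Z i \<omega> + a * indicator A \<omega> - b * indicator B \<omega>)"
    and Wj: "W j = (\<lambda>\<omega>. Z j \<omega> + b * indicator B \<omega> - a * indicator A \<omega>)"
    and Wk: "\<And>k. k \<noteq> i \<Longrightarrow> k \<noteq> j \<Longrightarrow> W k = Z k"
    using ij by (auto simp: W_def D_def fun_eq_iff)
  have tri: "W i \<in> borel_measurable M" "\<And>\<omega>. \<omega> \<in> space M \<Longrightarrow> \<bar>W i \<omega>\<bar> \<le> C" "icv_le M (Z i) (W i)"
    "expectation (\<lambda>\<omega>. (W i \<omega>)\<^sup>2) < expectation (\<lambda>\<omega>. (Z i \<omega>)\<^sup>2)"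
    unfolding Wi
    by (rule transfer_improves[OF ZD(1)[OF I(2)] ZD(2)[OF I(2)] sets pos _ _ ab(1,2,3,4,7)];
        simp add: A_def B_def)+
  have trj: "W j \<in> borel_measurable M" "\<And>\<omega>. \<omega> \<in> space M \<Longrightarrow> \<bar>W j \<omega>\<bar> \<le> C" "icv_le M (Z j) (W j)"
    "expectation (\<lambda>\<omega>. (W j \<omega>)\<^sup>2) < expectation (\<lambda>\<omega>. (Z j \<omega>)\<^sup>2)"
    unfolding Wj
    by (rule transfer_improves[OF ZD(1)[OF I(3)] ZD(2)[OF I(3)] sets(2,1) pos(2,1) _ _ ab(2,1,6,5) ab(7)[symmetric]];
        simp add: A_def B_def)+
  have "(\<Sum>k\<in>I. W k \<omega>) = (\<Sum>k\<in>I. Z k \<omega>)" for \<omega>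
    unfolding W_def using I by (simp add: sum.distrib sum_subtractf)
  moreover have "icv_le M (Y k) (W k)" if "k \<in> I" for k
    using icv_le_trans[OF ZD(3)[OF that]] tri(3) trj(3) Wk[of k] ZD(3)[OF that]
    by (cases "k = i"; cases "k = j") auto
  moreover have "W k \<in> borel_measurable M" "\<And>\<omega>. \<omega> \<in> space M \<Longrightarrow> \<bar>W k \<omega>\<bar> \<le> C" if "k \<in> I" for k
    using ZD(1,2)[OF that] tri(1,2) trj(1,2) Wk[of k] by (cases "k = i"; cases "k = j"; auto)+
  ultimately have "W \<in> improvements I C Y"
    using ZD(4) unfolding improvements_def by auto
  moreover have "energy I W < energy I Z"
    unfolding energy_def
  proof (rule sum_strict_mono_ex1[OF I(1)])
    show "\<forall>k\<in>I. expectation (\<lambda>\<omega>. (W k \<omega>)\<^sup>2) \<le> expectation (\<lambda>\<omega>. (Z k \<omega>)\<^sup>2)"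
    proof
      fix k
      show "expectation (\<lambda>\<omega>. (W k \<omega>)\<^sup>2) \<le> expectation (\<lambda>\<omega>. (Z k \<omega>)\<^sup>2)"
        using tri(4) trj(4) Wk[of k] by (cases "k = i"; cases "k = j") auto
    qed
  qed (use tri(4) I(2) in blast)
  ultimately show False using min by fastforce
qed

text \<open>Every failure of comonotonicity is visible at rational levels, so countably many null
  sets suffice to cover the points to be removed.\<close>

lemma energy_minimizer_comonotone:
  assumes I: "finite I" and Z: "Z \<in> improvements I C Y"
    and min: "\<And>W. W \<in> improvements I C Y \<Longrightarrow> energy I Z \<le> energy I W"
  shows "\<exists>N\<in>null_sets M. \<forall>i\<in>I. \<forall>j\<in>I. \<forall>x\<in>space M - N. \<forall>y\<in>space M - N.
    0 \<le> (Z i x - Z i y) * (Z j x - Z j y)"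
proof -
  define A where "A i j p q = {\<omega>\<in>space M. Z i \<omega> \<le> p \<and> q \<le> Z j \<omega>}" for i j p q
  define T where "T = {(i, j, p, q). (i, j, p, q) \<in> I \<times> I \<times> \<rat> \<times> \<rat> \<and> prob (A i j p q) = 0}"
  define N where "N = (\<Union>(i, j, p, q)\<in>T. A i j p q)"
  have "T \<subseteq> I \<times> I \<times> \<rat> \<times> \<rat>" by (auto simp: T_def)
  moreover have "countable (I \<times> I \<times> (\<rat> :: real set) \<times> (\<rat> :: real set))"
    using I countable_rat by (intro countable_SIGMA) (auto intro: countable_finite)
  ultimately have "countable T" by (rule countable_subset)
  moreover have "A i j p q \<in> null_sets M" if "(i, j, p, q) \<in> T" for i j p q
  proof -
    have "A i j p q \<in> sets M"
      using that improvementsD(1)[OF Z, of i] improvementsD(1)[OF Z, of j] unfolding A_def T_def by simp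
    then show ?thesis using that by (auto simp: T_def null_sets_def emeasure_eq_measure)
  qed
  ultimately have N: "N \<in> null_sets M"
    unfolding N_def by (intro null_sets_UN') auto
  have no: False if pt: "i \<in> I" "j \<in> I" "x \<in> space M - N" "y \<in> space M - N" "Z i x < Z i y" "Z j y < Z j x" for i j x y
  proof -
    obtain p where p: "p \<in> \<rat>" "Z i x < p" "p < Z i y" using Rats_dense_in_real[OF pt(5)] by blast
    obtain p' where p': "p' \<in> \<rat>" "p < p'" "p' < Z i y" using Rats_dense_in_real[OF p(3)] by blast
    obtain q where q: "q \<in> \<rat>" "Z j y < q" "q < Z j x" using Rats_dense_in_real[OF pt(6)] by blast
    obtain q' where q': "q' \<in> \<rat>" "q < q'" "q' < Z j x" using Rats_dense_in_real[OF q(3)] by blast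
    \<comment> \<open>The rational levels separate the values at \<open>x\<close> and
      \<open>y\<close> strictly, so one of two sets containing these points is null. Then
      \<open>x\<close> or \<open>y\<close> lies in \<open>N\<close>, a contradiction.\<close>
    have "prob (A i j p q') = 0 \<or> prob (A j i q p') = 0"
      unfolding A_def using energy_minimizer_no_crossing[OF I pt(1,2) Z min p'(2) q'(2)] .
    then have "(i, j, p, q') \<in> T \<or> (j, i, q, p') \<in> T"
      using pt(1,2) p p' q q' by (auto simp: T_def)
    moreover have "x \<in> A i j p q'" "y \<in> A j i q p'"
      using pt p p' q q' by (auto simp: A_def)
    ultimately show False using pt(3,4) unfolding N_def by blast
  qed
  show ?thesis
  proof (intro bexI[OF _ N] ballI)
    fix i j x y assume *: "i \<in> I" "j \<in> I" "x \<in> space M - N" "y \<in> space M - N"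
    show "0 \<le> (Z i x - Z i y) * (Z j x - Z j y)"
      using no[OF *] no[OF *(1,2,4,3)]
      by (cases "Z i x" "Z i y" rule: linorder_cases) (force simp: zero_le_mult_iff not_less)+
  qed
qed

section \<open>The comonotone improvement theorem\<close>

theorem comonotone_improvement:
  assumes I: "finite I" "I \<noteq> {}" and Y: "\<And>i. i \<in> I \<Longrightarrow> Y i \<in> Linf M"
  shows "\<exists>Z. (\<forall>i\<in>I. Z i \<in> Linf M \<and> icv_le M (Y i) (Z i)) \<and>
    (\<forall>\<omega>\<in>space M. (\<Sum>i\<in>I. Z i \<omega>) = (\<Sum>i\<in>I. Y i \<omega>)) \<and>
    (\<forall>i\<in>I. \<forall>j\<in>I. \<forall>x\<in>space M. \<forall>y\<in>space M. 0 \<le> (Z i x - Z i y) * (Z j x - Z j y))"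
proof -
  have "\<forall>i\<in>I. \<exists>c. \<forall>\<omega>\<in>space M. \<bar>Y i \<omega>\<bar> \<le> c" using Y by (auto simp: Linf_def)
  then obtain c where c: "\<And>i \<omega>. i \<in> I \<Longrightarrow> \<omega> \<in> space M \<Longrightarrow> \<bar>Y i \<omega>\<bar> \<le> c i" by metis
  \<comment> \<open>The largest of the individual bounds puts \<open>Y\<close> itself into the box,
    so the set of improvements is non-empty.\<close>
  define C where "C = Max (c ` I)"
  have YC: "\<bar>Y i \<omega>\<bar> \<le> C" if "i \<in> I" "\<omega> \<in> space M" for i \<omega>
    using c[OF that] I that unfolding C_def by (meson Max_ge finite_imageI imageI order_trans)
  have Ym: "Y i \<in> borel_measurable M" if "i \<in> I" for i using Y[OF that] by (simp add: Linf_def)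
  obtain W where W: "W \<in> improvements I C Y" "\<And>V. V \<in> improvements I C Y \<Longrightarrow> energy I W \<le> energy I V"
    using energy_minimizer_exists[where Y=Y and C=C, OF I(1) Ym YC] by blast
  obtain N where N: "N \<in> null_sets M"
    "\<And>i j x y. \<lbrakk>i \<in> I; j \<in> I; x \<in> space M - N; y \<in> space M - N\<rbrakk> \<Longrightarrow> 0 \<le> (W i x - W i y) * (W j x - W j y)"
    using energy_minimizer_comonotone[OF I(1) W] by blast
  have "\<exists>f. (\<forall>i\<in>I. mono (f i)) \<and> (\<forall>s. (\<Sum>i\<in>I. f i s) = s) \<and>
      (\<forall>i\<in>I. \<forall>x\<in>space M - N. f i (\<Sum>i\<in>I. W i x) = W i x)"
    using I by (rule comonotone_imp_mono_of_sum) (rule N(2))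
  then obtain f where f': "(\<forall>i\<in>I. mono (f i)) \<and> (\<forall>s. (\<Sum>i\<in>I. f i s) = s) \<and>
      (\<forall>i\<in>I. \<forall>x\<in>space M - N. f i (\<Sum>i\<in>I. W i x) = W i x)" by (rule exE)
  have f: "\<And>i. i \<in> I \<Longrightarrow> mono (f i)" "\<And>s. (\<Sum>i\<in>I. f i s) = s"
    "\<And>i x. i \<in> I \<Longrightarrow> x \<in> space M - N \<Longrightarrow> f i (\<Sum>i\<in>I. W i x) = W i x"
    by (simp_all only: f')
  define S where "S \<omega> = (\<Sum>i\<in>I. Y i \<omega>)" for \<omega>
  have Sm: "S \<in> borel_measurable M" unfolding S_def using Ym by measurable
  have Sb: "\<bar>S \<omega>\<bar> \<le> (\<Sum>i\<in>I. C)" if "\<omega> \<in> space M" for \<omega>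
    unfolding S_def using YC that by (intro order_trans[OF sum_abs] sum_mono)
  \<comment> \<open>Evaluating at \<open>S\<close> defines the allocation on \<open>N\<close> as
    well: monotonicity of the \<open>f i\<close> makes it comonotone at all points, and their
    summing to the identity makes it add up to \<open>S\<close> everywhere.\<close>
  define Z where "Z i \<omega> = f i (S \<omega>)" for i \<omega>
  have Zm: "Z i \<in> borel_measurable M" if "i \<in> I" for i
    unfolding Z_def using measurable_compose[OF Sm borel_measurable_mono[OF f(1)[OF that]]] .
  have "Z i \<in> Linf M" if i: "i \<in> I" for i
  proof -
    let ?K = "\<Sum>i\<in>I. C"
    have "\<bar>Z i \<omega>\<bar> \<le> \<bar>f i ?K\<bar> + \<bar>f i (- ?K)\<bar>" if "\<omega> \<in> space M" for \<omega>
      using monoD[OF f(1)[OF i], of "S \<omega>" ?K] monoD[OF f(1)[OF i], of "- ?K" "S \<omega>"] Sb[OF that]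
      unfolding Z_def by linarith
    then show ?thesis using Zm[OF i] unfolding Linf_def by blast
  qed
  moreover have "icv_le M (Y i) (Z i)" if i: "i \<in> I" for i
    unfolding icv_le_def
  proof (intro allI impI)
    fix \<phi> :: "real \<Rightarrow> real" assume phi: "mono \<phi> \<and> concave_on UNIV \<phi>"
    have "AE \<omega> in M. \<omega> \<notin> N" using N(1) by (rule AE_not_in)
    \<comment> \<open>Off \<open>N\<close> the new allocation coincides with the minimizer
      \<open>W\<close>, so it inherits the dominance over \<open>Y\<close>.\<close>
    then have "AE \<omega> in M. \<phi> (W i \<omega>) = \<phi> (Z i \<omega>)"
      using AE_space
    proof eventually_elim
      case (elim \<omega>)
      then show ?case
        using f(3)[OF i, of \<omega>] improvementsD(4)[OF W(1), of \<omega>] by (simp add: Z_def S_def)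
    qed
    moreover have "\<phi> \<in> borel_measurable borel" using phi by (simp add: borel_measurable_mono)
    ultimately have "expectation (\<lambda>\<omega>. \<phi> (W i \<omega>)) = expectation (\<lambda>\<omega>. \<phi> (Z i \<omega>))"
      using measurable_compose[OF improvementsD(1)[OF W(1) i]] measurable_compose[OF Zm[OF i]]
      by (intro integral_cong_AE) auto
    then show "expectation (\<lambda>\<omega>. \<phi> (Y i \<omega>)) \<le> expectation (\<lambda>\<omega>. \<phi> (Z i \<omega>))"
      using improvementsD(3)[OF W(1) i] phi unfolding icv_le_def by auto
  qed
  moreover have "0 \<le> (Z i x - Z i y) * (Z j x - Z j y)" if "i \<in> I" "j \<in> I" for i j x y
    using monoD[OF f(1)[OF that(1)]] monoD[OF f(1)[OF that(2)]] unfolding Z_def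
    by (cases "S x \<le> S y") (auto simp: zero_le_mult_iff not_le less_imp_le)
  ultimately show ?thesis using f(2) by (intro exI[of _ Z]) (auto simp: Z_def S_def)
qed

end

section \<open>Pareto optima and weighted suprema\<close>

text \<open>Preservation of second-order dominance turns the improvement in the concave order into
  one in utility, and individual rationality then follows by transitivity.\<close>

lemma IR_comonotone_improvement:
  assumes "prob_space M" "1 \<le> n" "\<forall>i\<in>{1..n}. ssd_preserving M (U i)" "Y \<in> IR M n X U"
  shows "\<exists>Z\<in>IR M n X U \<inter> allocsC M n X. \<forall>i\<in>{1..n}. U i (Y i) \<le> U i (Z i)"
proof -
  interpret prob_space M by fact
  have Y: "\<And>i. i \<in> {1..n} \<Longrightarrow> Y i \<in> Linf M"
    "\<And>\<omega>. \<omega> \<in> space M \<Longrightarrow> (\<Sum>i=1..n. Y i \<omega>) = (\<Sum>i=1..n. X i \<omega>)"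
    "\<And>i. i \<in> {1..n} \<Longrightarrow> U i (X i) \<le> U i (Y i)"
    using assms(4) unfolding IR_def allocs_def by auto
  have "{1..n} \<noteq> {}" using assms(2) by simp
  from comonotone_improvement[where Y=Y, OF _ this Y(1)]
  obtain Z where Z: "\<And>i. i \<in> {1..n} \<Longrightarrow> Z i \<in> Linf M" "\<And>i. i \<in> {1..n} \<Longrightarrow> icv_le M (Y i) (Z i)"
    "\<And>\<omega>. \<omega> \<in> space M \<Longrightarrow> (\<Sum>i=1..n. Z i \<omega>) = (\<Sum>i=1..n. Y i \<omega>)" "comonotone M n Z"
    unfolding comonotone_def by blast
  have le: "U i (Y i) \<le> U i (Z i)" if "i \<in> {1..n}" for i
    using assms(3) that Y(1)[OF that] Z(1,2)[OF that] unfolding ssd_preserving_def by blast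
  have "Z \<in> allocs M n X" using Y(2) Z(1,3) unfolding allocs_def by simp
  then have "Z \<in> IR M n X U \<inter> allocsC M n X"
    using Z(4) order_trans[OF Y(3) le] unfolding IR_def allocsC_def by auto
  then show ?thesis using le by blast
qed

theorem mainTheorem4:
  fixes M :: "'a measure" and n :: nat
    and X :: "nat \<Rightarrow> 'a \<Rightarrow> real"
    and U :: "nat \<Rightarrow> ('a \<Rightarrow> real) \<Rightarrow> real"
  assumes "prob_space M" and "atomless M" and "n \<ge> 2"
    and "\<forall>i\<in>{1..n}. X i \<in> Linf M"
    and "\<forall>i\<in>{1..n}. concave_functional M (U i)"
    and "\<forall>i\<in>{1..n}. ssd_preserving M (U i)"
    and "\<forall>i\<in>{1..n}. \<forall>Z\<in>Linf M. continuous_on UNIV (\<lambda>c. U i (\<lambda>\<omega>. Z \<omega> + c))"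
    and "\<forall>i\<in>{1..n}. \<forall>Z\<in>Linf M. strict_mono (\<lambda>c. U i (\<lambda>\<omega>. Z \<omega> + c))"
    and "\<forall>i\<in>{1..n}. \<forall>Z\<in>Linf M. filterlim (\<lambda>c. U i (\<lambda>\<omega>. Z \<omega> + c)) at_top at_top"
  shows "(PO M n X U \<noteq> {} \<longleftrightarrow> CPO M n X U \<noteq> {}) \<and>
    (PO M n X U \<noteq> {} \<and> CPO M n X U \<noteq> {} \<longrightarrow>
      (\<forall>w\<in>weights n.
        (SUP Y\<in>IR M n X U. ereal (\<Sum>i=1..n. w i * U i (Y i))) =
        (SUP Y\<in>IR M n X U \<inter> allocsC M n X. ereal (\<Sum>i=1..n. w i * U i (Y i)))))"
proof (intro conjI impI ballI)
  have "1 \<le> n" using assms(3) by simp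
  note improve = IR_comonotone_improvement[OF assms(1) this assms(6), where X=X]
  show "PO M n X U \<noteq> {} \<longleftrightarrow> CPO M n X U \<noteq> {}"
  proof
    assume "PO M n X U \<noteq> {}"
    then obtain Y where Y: "Y \<in> PO M n X U" by blast
    then have "Y \<in> IR M n X U" by (simp add: PO_def)
    from improve[OF this] obtain Z where Z: "Z \<in> IR M n X U \<inter> allocsC M n X"
      and le: "\<And>i. i \<in> {1..n} \<Longrightarrow> U i (Y i) \<le> U i (Z i)" by blast
    \<comment> \<open>\<open>Z\<close> is undominated even among all individually rational
      allocations: whatever dominates \<open>Z\<close> also dominates \<open>Y\<close>.\<close>
    have "\<not> (\<exists>V\<in>IR M n X U. (\<forall>i\<in>{1..n}. U i (V i) \<ge> U i (Z i)) \<and> (\<exists>i\<in>{1..n}. U i (V i) > U i (Z i)))"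
    proof clarify
      fix V i assume "V \<in> IR M n X U" "\<forall>i\<in>{1..n}. U i (Z i) \<le> U i (V i)"
        "i \<in> {1..n}" "U i (Z i) < U i (V i)"
      then show False using Y le unfolding PO_def by (blast intro: order_trans le_less_trans)
    qed
    then have "Z \<in> CPO M n X U" using Z unfolding CPO_def by blast
    then show "CPO M n X U \<noteq> {}" by blast
  next
    assume "CPO M n X U \<noteq> {}"
    then obtain Y where Y: "Y \<in> CPO M n X U" by blast
    have "\<not> (\<exists>V\<in>IR M n X U. (\<forall>i\<in>{1..n}. U i (V i) \<ge> U i (Y i)) \<and> (\<exists>i\<in>{1..n}. U i (V i) > U i (Y i)))"
    proof clarify
      fix V i assume V: "V \<in> IR M n X U" "\<forall>i\<in>{1..n}. U i (Y i) \<le> U i (V i)"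
        "i \<in> {1..n}" "U i (Y i) < U i (V i)"
      \<comment> \<open>\<open>V\<close> may fail to be comonotone, so it is first improved to a
        comonotone \<open>Z\<close>, which still dominates \<open>Y\<close>, strictly for agent
        \<open>i\<close>.\<close>
      from improve[OF V(1)] obtain Z where "Z \<in> IR M n X U \<inter> allocsC M n X"
        "\<And>i. i \<in> {1..n} \<Longrightarrow> U i (V i) \<le> U i (Z i)" by blast
      with V Y show False unfolding CPO_def by (blast intro: order_trans less_le_trans)
    qed
    then have "Y \<in> PO M n X U" using Y unfolding PO_def CPO_def by blast
    then show "PO M n X U \<noteq> {}" by blast
  qed
  fix w assume w: "w \<in> weights n"
  show "(SUP Y\<in>IR M n X U. ereal (\<Sum>i=1..n. w i * U i (Y i))) =
    (SUP Y\<in>IR M n X U \<inter> allocsC M n X. ereal (\<Sum>i=1..n. w i * U i (Y i)))"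
  proof (rule antisym)
    show "(SUP Y\<in>IR M n X U. ereal (\<Sum>i=1..n. w i * U i (Y i)))
      \<le> (SUP Y\<in>IR M n X U \<inter> allocsC M n X. ereal (\<Sum>i=1..n. w i * U i (Y i)))"
    \<comment> \<open>Non-negative weights turn the agentwise improvement into one of each weighted
      sum; the reverse inequality is inclusion of the index sets.\<close>
    proof (rule SUP_mono)
      fix Y assume "Y \<in> IR M n X U"
      from improve[OF this] obtain Z where Z: "Z \<in> IR M n X U \<inter> allocsC M n X"
        "\<And>i. i \<in> {1..n} \<Longrightarrow> U i (Y i) \<le> U i (Z i)" by blast
      have "(\<Sum>i=1..n. w i * U i (Y i)) \<le> (\<Sum>i=1..n. w i * U i (Z i))"
        using w Z(2) by (intro sum_mono mult_left_mono) (auto simp: weights_def)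
      with Z(1) show "\<exists>Z\<in>IR M n X U \<inter> allocsC M n X.
        ereal (\<Sum>i=1..n. w i * U i (Y i)) \<le> ereal (\<Sum>i=1..n. w i * U i (Z i))" by auto
    qed
  qed (intro SUP_subset_mono, auto)
qed

end
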